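(* Let $\ell\ge 1$, let $A_1,\dots,A_\ell,B_1,\dots,B_\ell$ be finite multisets of complex numbers and let $\alpha_1,\dots,\alpha_\ell,\beta_1,\dots,\beta_\ell$ be complex numbers, all of these numbers having real part of absolute value at most $1/20$. Define $$\mathcal Q:=\sum_{\substack{M_1,\dots,M_\ell,N_1,\dots,N_\ell\ge 0\\ \min(M_j,N_j)=0\ (1\le j\le \ell)\\ \sum_{j=1}^\ell M_j=\sum_{j=1}^\ell N_j}}\ \prod_{j=1}^\ell \Sigma_{A_j,B_j,\alpha_j,\beta_j}(M_j,N_j)\,X^{M_j(1-\beta_j)-N_j\alpha_j}.$$ Then $$\mathcal Q=\prod_{j=1}^\ell\bigl(1-X^{1-\alpha_j-\beta_j}\bigr)\,\mathcal C\bigl(A_1\cup\dots\cup A_\ell\cup\{-\beta_1,\dots,-\beta_\ell\},\;B_1\cup\dots\cup B_\ell\cup\{-\alpha_1,\dots,-\alpha_\ell\}\bigr).$$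
   Context: Fix a real number $p>1$ (in the paper $p$ is a prime) and put $X=1/p$; for complex $z$, $X^z:=p^{-z}$. For a finite multiset $A$ of complex numbers and an integer $n$, define $A(n)=\sum\prod_{a\in A}X^{a j_a}$, the sum over all tuples $(j_a)_{a\in A}$ of nonnegative integers with $\sum_a j_a=n$ (so $A(n)=\tau_A(p^n)$ where $\prod_{a\in A}\zeta(s+a)=\sum_n\tau_A(n)n^{-s}$); in particular $A(n)=0$ for $n<0$, $A(0)=1$, and for the empty multiset $\emptyset(n)=1$ if $n=0$ and $0$ otherwise. For complex $\alpha$, $A_\alpha:=\{a+\alpha:a\in A\}$. All unions are multiset unions. For multisets $A,B$ let $\mathcal C(A,B):=\sum_{M=0}^\infty A(M)B(M)X^M$. For finite multisets $A,B$, complex $\alpha,\beta$ and integers $M,N\ge0$ define $$\Sigma_{A,B,\alpha,\beta}(M,N)=\sum_{d,j,k\ge 0}\ \sum_{q\in\{0,1\}}(-1)^qX^{d(\alpha+\beta)}A_{-\alpha}\bigl(j+q+d-\min(q+d,N)\bigr)B_{-\beta}\bigl(k+q+d-\min(q+d,M)\bigr)X^{2q+d+j+k-\min(q+d,M)-\min(q+d,N)}.$$ The smallness of the real parts guarantees absolute convergence of all series involved. *)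

theory Defs
  imports "HOL-Analysis.Analysis" "HOL-Library.Multiset" "HOL-Library.FuncSet"
begin

definition Xpow :: "real \<Rightarrow> complex \<Rightarrow> complex" where
  "Xpow p z = complex_of_real p powr (- z)"

text \<open>
  Tuples indexed by the elements of a multiset \<open>A\<close>, counted with multiplicity, are the
  extensional functions on the set of pairs \<open>(a, i)\<close> where \<open>i\<close> numbers the copies of \<open>a\<close>.
\<close>

definition copies :: "complex multiset \<Rightarrow> (complex \<times> nat) set" where
  "copies A = {(a, i). i < count A a}"

definition coeff_tuples :: "complex multiset \<Rightarrow> int \<Rightarrow> (complex \<times> nat \<Rightarrow> nat) set" where
  "coeff_tuples A n = {f \<in> copies A \<rightarrow>\<^sub>E UNIV. (\<Sum>c\<in>copies A. int (f c)) = n}"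

text \<open>\<open>mcoeff p A n\<close> is the number usually written \<open>A(n)\<close>, i.e. \<open>\<tau>\<^sub>A(p\<^sup>n)\<close>.\<close>

definition mcoeff :: "real \<Rightarrow> complex multiset \<Rightarrow> int \<Rightarrow> complex" where
  "mcoeff p A n = (\<Sum>f\<in>coeff_tuples A n. \<Prod>c\<in>copies A. Xpow p (fst c * of_nat (f c)))"

definition mshift :: "complex multiset \<Rightarrow> complex \<Rightarrow> complex multiset" where
  "mshift A \<alpha> = image_mset (\<lambda>a. a + \<alpha>) A"

definition C_term :: "real \<Rightarrow> complex multiset \<Rightarrow> complex multiset \<Rightarrow> nat \<Rightarrow> complex" where
  "C_term p A B M = mcoeff p A (int M) * mcoeff p B (int M) * Xpow p (of_nat M)"

definition C_series :: "real \<Rightarrow> complex multiset \<Rightarrow> complex multiset \<Rightarrow> complex" where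
  "C_series p A B = (\<Sum>\<^sub>\<infinity>M. C_term p A B M)"

definition Sigma_index :: "(nat \<times> nat \<times> nat \<times> nat) set" where
  "Sigma_index = UNIV \<times> UNIV \<times> UNIV \<times> {0, 1}"

definition Sigma_term ::
  "real \<Rightarrow> complex multiset \<Rightarrow> complex multiset \<Rightarrow> complex \<Rightarrow> complex \<Rightarrow> nat \<Rightarrow> nat \<Rightarrow>
    nat \<times> nat \<times> nat \<times> nat \<Rightarrow> complex" where
  "Sigma_term p A B \<alpha> \<beta> M N = (\<lambda>(d, j, k, q).
     (- 1) ^ q * Xpow p (of_nat d * (\<alpha> + \<beta>))
     * mcoeff p (mshift A (- \<alpha>)) (int j + int q + int d - int (min (q + d) N))
     * mcoeff p (mshift B (- \<beta>)) (int k + int q + int d - int (min (q + d) M))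
     * Xpow p (of_int (2 * int q + int d + int j + int k
                         - int (min (q + d) M) - int (min (q + d) N))))"

definition Sigma_series ::
  "real \<Rightarrow> complex multiset \<Rightarrow> complex multiset \<Rightarrow> complex \<Rightarrow> complex \<Rightarrow> nat \<Rightarrow> nat \<Rightarrow> complex" where
  "Sigma_series p A B \<alpha> \<beta> M N = (\<Sum>\<^sub>\<infinity>x\<in>Sigma_index. Sigma_term p A B \<alpha> \<beta> M N x)"

definition Q_index :: "nat \<Rightarrow> ((nat \<Rightarrow> nat) \<times> (nat \<Rightarrow> nat)) set" where
  "Q_index l = {(M, N). M \<in> {1..l} \<rightarrow>\<^sub>E UNIV \<and> N \<in> {1..l} \<rightarrow>\<^sub>E UNIV \<and>
     (\<forall>j\<in>{1..l}. min (M j) (N j) = 0) \<and> (\<Sum>j=1..l. M j) = (\<Sum>j=1..l. N j)}"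

definition Q_term ::
  "real \<Rightarrow> nat \<Rightarrow> (nat \<Rightarrow> complex multiset) \<Rightarrow> (nat \<Rightarrow> complex multiset) \<Rightarrow>
    (nat \<Rightarrow> complex) \<Rightarrow> (nat \<Rightarrow> complex) \<Rightarrow> (nat \<Rightarrow> nat) \<times> (nat \<Rightarrow> nat) \<Rightarrow> complex" where
  "Q_term p l A B \<alpha> \<beta> = (\<lambda>(M, N).
     \<Prod>j=1..l. Sigma_series p (A j) (B j) (\<alpha> j) (\<beta> j) (M j) (N j)
              * Xpow p (of_nat (M j) * (1 - \<beta> j) - of_nat (N j) * \<alpha> j))"

definition Q_series ::
  "real \<Rightarrow> nat \<Rightarrow> (nat \<Rightarrow> complex multiset) \<Rightarrow> (nat \<Rightarrow> complex multiset) \<Rightarrow>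
    (nat \<Rightarrow> complex) \<Rightarrow> (nat \<Rightarrow> complex) \<Rightarrow> complex" where
  "Q_series p l A B \<alpha> \<beta> = (\<Sum>\<^sub>\<infinity>x\<in>Q_index l. Q_term p l A B \<alpha> \<beta> x)"

end

theory Submission
  imports Defs
begin

text \<open>
  Write \<open>f(a) = A\<^sub>-\<^sub>\<alpha>(a)\<close>, \<open>g(b) = B\<^sub>-\<^sub>\<beta>(b)\<close> and let \<open>y = X\<^sup>\<alpha>\<^sup>+\<^sup>\<beta>\<^sup>-\<^sup>1\<close>. For fixed arguments \<open>a\<close>, \<open>b\<close> of the two
  coefficients, the sum over \<open>d\<close> and \<open>q\<close> telescopes, so that \<open>\<Sigma>(M, N)\<close> is the sum of
  \<open>f(a) g(b) X\<^sup>a\<^sup>+\<^sup>b y\<^sup>L\<close> with \<open>L = min (a + N) (b + M)\<close>. After multiplication by the weight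
  \<open>X\<close> to the power \<open>M (1/2 - \<beta>) + N (1/2 - \<alpha>)\<close> this depends only on \<open>e = M - N\<close>, and is the
  coefficient of \<open>z\<^sup>e\<close> in a product of geometric series in \<open>z\<close> and \<open>1/z\<close> that converges on the
  unit circle. The constraint \<open>\<Sum>M = \<Sum>N\<close> picks the constant term of the product over \<open>j\<close> (and makes
  the remaining weights \<open>X\<close> to the power \<open>(M - N)/2\<close> cancel); the same product is the generating
  function of the right-hand side. Constant terms are extracted by averaging over \<open>n\<close>-th roots of unity
  and letting \<open>n\<close> tend to infinity.
\<close>

no_notation Infinite_Set_Sum.abs_summable_on (infix "abs'_summable'_on" 50)

subsection \<open>Absolutely summable families and constant terms\<close>

lemma abs_summable_on_times:
  fixes f :: "'a \<Rightarrow> complex" and g :: "'b \<Rightarrow> complex"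
  assumes f: "f abs_summable_on A" and g: "g abs_summable_on B"
  shows "(\<lambda>(x, y). f x * g y) abs_summable_on A \<times> B"
proof (rule summable_on_SigmaI)
  fix x assume "x \<in> A"
  show "((\<lambda>y. norm (case (x, y) of (x, y) \<Rightarrow> f x * g y)) has_sum norm (f x) * infsum (\<lambda>y. norm (g y)) B) B"
    using has_sum_cmult_right[OF has_sum_infsum[OF g]] by (simp add: norm_mult)
next
  show "(\<lambda>x. norm (f x) * infsum (\<lambda>y. norm (g y)) B) summable_on A"
    using f by (rule summable_on_cmult_left)
qed auto

lemma has_sum_times:
  fixes f :: "'a \<Rightarrow> complex" and g :: "'b \<Rightarrow> complex"
  assumes f: "f abs_summable_on A" "(f has_sum s) A" and g: "g abs_summable_on B" "(g has_sum t) B"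
  shows "((\<lambda>(x, y). f x * g y) has_sum s * t) (A \<times> B)"
proof (rule has_sum_SigmaI)
  fix x assume "x \<in> A"
  show "((\<lambda>y. case (x, y) of (x, y) \<Rightarrow> f x * g y) has_sum f x * t) B"
    using has_sum_cmult_right[OF g(2)] by simp
next
  show "((\<lambda>x. f x * t) has_sum s * t) A"
    using f(2) by (rule has_sum_cmult_left)
next
  show "(\<lambda>(x, y). f x * g y) summable_on A \<times> B"
    using abs_summable_on_times[OF f(1) g(1)] by (rule abs_summable_summable)
qed

text \<open>A finite set of choice functions lies in the box spanned by its coordinate projections.
  Over that box the sum of norms factors into finite sums, one per coordinate, so the product of the
  full norm sums bounds every finite partial sum.\<close>

lemma abs_summable_on_prod_PiE:
  fixes f :: "'a \<Rightarrow> 'b \<Rightarrow> complex"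
  assumes fin: "finite A" and f: "\<And>x. x \<in> A \<Longrightarrow> f x abs_summable_on B x"
  shows "(\<lambda>g. \<Prod>x\<in>A. f x (g x)) abs_summable_on Pi\<^sub>E A B"
proof (rule nonneg_bdd_above_summable_on)
  show "bdd_above (sum (\<lambda>g. norm (\<Prod>x\<in>A. f x (g x))) ` {F. F \<subseteq> Pi\<^sub>E A B \<and> finite F})"
  proof (rule bdd_aboveI2)
    fix F assume "F \<in> {F. F \<subseteq> Pi\<^sub>E A B \<and> finite F}"
    hence F: "F \<subseteq> Pi\<^sub>E A B" "finite F" by auto
    define P where "P x = (\<lambda>g. g x) ` F" for x
    have "(\<Sum>g\<in>F. norm (\<Prod>x\<in>A. f x (g x))) \<le> (\<Sum>g\<in>Pi\<^sub>E A P. norm (\<Prod>x\<in>A. f x (g x)))"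
      using F fin by (intro sum_mono2 finite_PiE) (auto simp: P_def PiE_iff subset_iff)
    also have "\<dots> = (\<Prod>x\<in>A. \<Sum>y\<in>P x. norm (f x y))"
      using fin F by (subst prod_sum_PiE) (auto simp: P_def prod_norm[symmetric] )
    also have "\<dots> \<le> (\<Prod>x\<in>A. \<Sum>\<^sub>\<infinity>y\<in>B x. norm (f x y))"
      using F by (intro prod_mono conjI finite_sum_le_infsum sum_nonneg f) (auto simp: P_def)
    finally show "(\<Sum>g\<in>F. norm (\<Prod>x\<in>A. f x (g x))) \<le> (\<Prod>x\<in>A. \<Sum>\<^sub>\<infinity>y\<in>B x. norm (f x y))" .
  qed
qed auto

section \<open>Averages over \<open>n\<close>-th roots of unity, a discrete form of integration over
  the unit circle\<close>

definition root_average :: "nat \<Rightarrow> int \<Rightarrow> complex" where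
  "root_average n d = (\<Sum>k<n. cis (2 * pi * real k / real n) powi d) / n"

lemma norm_root_average_le: "norm (root_average n d) \<le> 1"
proof (cases "n = 0")
  case False
  have "norm (\<Sum>k<n. cis (2 * pi * real k / real n) powi d) \<le> (\<Sum>k<n. 1)"
    by (rule sum_norm_le) (simp add: norm_power_int)
  with False show ?thesis by (simp add: root_average_def norm_divide)
qed (simp add: root_average_def)

lemma root_average_0: "n > 0 \<Longrightarrow> root_average n 0 = 1"
  by (simp add: root_average_def)

text \<open>The summands are the powers of \<open>w = cis (2 * pi * d / n)\<close>. Here
  \<open>w ^ n = 1\<close>, while \<open>w \<noteq> 1\<close> because \<open>n\<close> cannot divide
  a nonzero \<open>d\<close> of smaller absolute value; so the geometric sum vanishes.\<close>

lemma root_average_eq_0: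
  assumes "d \<noteq> 0" "\<bar>d\<bar> < int n"
  shows "root_average n d = 0"
proof -
  have n: "n > 0" using assms by auto
  define w where "w = cis (2 * pi * d / n)"
  have "w \<noteq> 1"
  proof
    assume "w = 1"
    hence "cos (2 * pi * d / n) = 1" by (simp add: w_def complex_eq_iff)
    then obtain k :: int where "2 * pi * d / n = real_of_int k * 2 * pi"
      unfolding cos_one_2pi_int by blast
    hence "real_of_int d = real_of_int (k * int n)" using n by (simp add: field_simps)
    hence "d = k * int n" by linarith
    with assms show False
      by (metis abs_mult abs_of_nat dvd_imp_le_int dvd_triv_right linorder_not_less)
  qed
  moreover have "w ^ n = 1"
  proof -
    have "w ^ n = cis (real n * (2 * pi * d / n))" by (simp only: w_def Complex.DeMoivre)
    also have "real n * (2 * pi * d / n) = 2 * pi * d" using n by simp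
    finally show ?thesis by (simp add: cis_multiple_2pi)
  qed
  moreover have "cis (2 * pi * real k / real n) powi d = w ^ k" for k
    by (simp only: w_def Complex.DeMoivre cis_power_int) (simp add: mult_ac)
  ultimately show ?thesis
    by (simp add: root_average_def geometric_sum)
qed

text \<open>A finite set \<open>F\<close> carries all but \<open>e / 2\<close> of the total norm.
  Once \<open>n\<close> exceeds every exponent on \<open>F\<close>, the root average is there
  exactly the indicator of \<open>\<delta> i = 0\<close>; outside \<open>F\<close> the error is
  controlled by the tail of the norms.\<close>

lemma constant_term_tendsto:
  fixes f :: "'a \<Rightarrow> complex" and \<delta> :: "'a \<Rightarrow> int"
  assumes f: "f abs_summable_on I"
  shows "(\<lambda>n. \<Sum>\<^sub>\<infinity>i\<in>I. f i * root_average n (\<delta> i)) \<longlonglongrightarrow> infsum f {i\<in>I. \<delta> i = 0}"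
proof (rule LIMSEQ_I)
  fix e :: real assume e: "e > 0"
  obtain F where F: "finite F" "F \<subseteq> I"
    "dist (\<Sum>i\<in>F. norm (f i)) (\<Sum>\<^sub>\<infinity>i\<in>I. norm (f i)) \<le> e / 2"
    using infsum_finite_approximation[OF f, of "e / 2"] e by auto
  have tail: "(\<Sum>\<^sub>\<infinity>i\<in>I - F. norm (f i)) \<le> e / 2"
  proof -
    have "(\<Sum>\<^sub>\<infinity>i\<in>I. norm (f i)) = (\<Sum>\<^sub>\<infinity>i\<in>F. norm (f i)) + (\<Sum>\<^sub>\<infinity>i\<in>I - F. norm (f i))"
      using F summable_on_subset_banach[OF f, of "I - F"]
      by (subst infsum_Un_disjoint[symmetric]) (auto intro!: arg_cong2[of _ _ _ _ infsum])
    with F show ?thesis by (simp add: dist_real_def)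
  qed
  \<comment> \<open>The sum over \<open>F\<close> dominates each single
    \<open>\<bar>\<delta> i\<bar>\<close>, and \<open>Suc\<close> makes the inequality
    strict.\<close>
  define n0 where "n0 = Suc (nat (\<Sum>i\<in>F. \<bar>\<delta> i\<bar>))"
  have "norm ((\<Sum>\<^sub>\<infinity>i\<in>I. f i * root_average n (\<delta> i)) - infsum f {i\<in>I. \<delta> i = 0}) < e"
    if n: "n \<ge> n0" for n
  proof -
    have n': "n > 0" using n by (simp add: n0_def)
    define h where "h i = f i * root_average n (\<delta> i)" for i
    define h0 where "h0 i = (if \<delta> i = 0 then f i else 0)" for i
    have h: "h abs_summable_on I" "h0 abs_summable_on I"
      using norm_root_average_le
      by (intro Infinite_Sum.abs_summable_on_comparison_test[OF f];
          simp add: h_def h0_def norm_mult mult_left_le)+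
    have eq0: "infsum f {i\<in>I. \<delta> i = 0} = infsum h0 I"
      by (rule infsum_cong_neutral) (auto simp: h0_def)
    have zero: "h i - h0 i = 0" if "i \<in> F" for i
    proof (cases "\<delta> i = 0")
      case False
      have "\<bar>\<delta> i\<bar> \<le> (\<Sum>i\<in>F. \<bar>\<delta> i\<bar>)" using that F by (intro member_le_sum) auto
      hence "\<bar>\<delta> i\<bar> < int n" using n by (simp add: n0_def)
      thus ?thesis using False by (simp add: h_def h0_def root_average_eq_0)
    qed (simp add: h_def h0_def root_average_0 n')
    \<comment> \<open>The difference costs only \<open>norm (f i)\<close>: both terms coincide if
      \<open>\<delta> i = 0\<close>, and otherwise \<open>h0 i\<close> is zero.\<close>
    have le: "norm (h i - h0 i) \<le> norm (f i)" for i
      using norm_root_average_le[of n "\<delta> i"]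
      by (auto simp: h_def h0_def root_average_0 n' norm_mult intro: mult_left_le)
    have "infsum h I - infsum h0 I = infsum (\<lambda>i. h i - h0 i) I"
      using infsum_add[of h I "\<lambda>i. - h0 i"] h[THEN abs_summable_summable]
      by (simp add: infsum_uminus summable_on_uminus)
    also have "\<dots> = infsum (\<lambda>i. h i - h0 i) (I - F)"
      by (rule infsum_cong_neutral) (use zero in auto)
    also have "norm \<dots> \<le> (\<Sum>\<^sub>\<infinity>i\<in>I - F. norm (h i - h0 i))"
      by (intro norm_infsum_bound Infinite_Sum.abs_summable_on_comparison_test'[OF summable_on_subset_banach[OF f]] le) auto
    also have "\<dots> \<le> (\<Sum>\<^sub>\<infinity>i\<in>I - F. norm (f i))"
      by (intro infsum_mono le summable_on_subset_banach[OF f]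
          Infinite_Sum.abs_summable_on_comparison_test'[OF summable_on_subset_banach[OF f]]) auto
    also have "\<dots> < e" using tail e by simp
    finally show ?thesis by (simp add: eq0 h_def[abs_def])
  qed
  thus "\<exists>n0. \<forall>n\<ge>n0. norm ((\<Sum>\<^sub>\<infinity>i\<in>I. f i * root_average n (\<delta> i)) - infsum f {i\<in>I. \<delta> i = 0}) < e"
    by blast
qed

lemma has_sum_sum:
  fixes f :: "'a \<Rightarrow> 'b \<Rightarrow> complex"
  assumes "\<And>k. k \<in> K \<Longrightarrow> (f k has_sum s k) I"
  shows "((\<lambda>i. \<Sum>k\<in>K. f k i) has_sum (\<Sum>k\<in>K. s k)) I"
  using assms by (induction K rule: infinite_finite_induct) (auto intro: has_sum_add)

text \<open>Exchanging the finite average with the infinite sum expresses the averaged family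
  through values of its Laurent series at points of the unit circle.\<close>

lemma infsum_root_average:
  fixes f :: "'a \<Rightarrow> complex" and \<delta> :: "'a \<Rightarrow> int"
  assumes f: "f abs_summable_on I"
  shows "(\<Sum>\<^sub>\<infinity>i\<in>I. f i * root_average n (\<delta> i)) =
    (\<Sum>k<n. \<Sum>\<^sub>\<infinity>i\<in>I. f i * cis (2 * pi * real k / real n) powi \<delta> i) / n"
proof -
  have "(\<lambda>i. f i * cis (2 * pi * real k / real n) powi \<delta> i) summable_on I" for k
    by (rule abs_summable_summable) (use f in \<open>simp add: norm_mult norm_power_int\<close>)
  hence "((\<lambda>i. (\<Sum>k<n. f i * cis (2 * pi * real k / real n) powi \<delta> i)) has_sum
    (\<Sum>k<n. \<Sum>\<^sub>\<infinity>i\<in>I. f i * cis (2 * pi * real k / real n) powi \<delta> i)) I"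
    by (intro has_sum_sum) auto
  from has_sum_divide_const[OF this, of "of_nat n"] show ?thesis
    by (intro infsumI) (simp add: root_average_def sum_distrib_left sum_divide_distrib)
qed

text \<open>Both constant terms are limits of the same averages, since these depend only on the
  values on the unit circle. The exponent maps need not be injective, so multiple series can be
  compared directly without first collecting equal powers of \<open>z\<close>.\<close>

lemma constant_term_eqI:
  fixes f :: "'a \<Rightarrow> complex" and g :: "'b \<Rightarrow> complex" and \<delta> :: "'a \<Rightarrow> int" and \<epsilon> :: "'b \<Rightarrow> int"
  assumes f: "f abs_summable_on I" and g: "g abs_summable_on J"
    and eq: "\<And>z. norm z = 1 \<Longrightarrow> (\<Sum>\<^sub>\<infinity>i\<in>I. f i * z powi \<delta> i) = (\<Sum>\<^sub>\<infinity>j\<in>J. g j * z powi \<epsilon> j)"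
  shows "infsum f {i\<in>I. \<delta> i = 0} = infsum g {j\<in>J. \<epsilon> j = 0}"
proof (rule LIMSEQ_unique)
  show "(\<lambda>n. \<Sum>\<^sub>\<infinity>i\<in>I. f i * root_average n (\<delta> i)) \<longlonglongrightarrow> infsum f {i\<in>I. \<delta> i = 0}"
    using f by (rule constant_term_tendsto)
  have "(\<Sum>\<^sub>\<infinity>i\<in>I. f i * root_average n (\<delta> i)) = (\<Sum>\<^sub>\<infinity>j\<in>J. g j * root_average n (\<epsilon> j))" for n
    by (simp add: infsum_root_average f g eq)
  thus "(\<lambda>n. \<Sum>\<^sub>\<infinity>i\<in>I. f i * root_average n (\<delta> i)) \<longlonglongrightarrow> infsum g {j\<in>J. \<epsilon> j = 0}"
    using constant_term_tendsto[OF g] by simp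
qed

subsection \<open>Generating functions\<close>

lemma Xpow_add: "Xpow p (a + b) = Xpow p a * Xpow p b"
  by (simp add: Xpow_def powr_add[symmetric])

lemma Xpow_nonzero [simp]: "p > 0 \<Longrightarrow> Xpow p a \<noteq> 0"
  by (simp add: Xpow_def)

lemma Xpow_0 [simp]: "p > 0 \<Longrightarrow> Xpow p 0 = 1"
  by (simp add: Xpow_def)

lemma Xpow_of_nat_mult: "p > 0 \<Longrightarrow> Xpow p (of_nat n * a) = Xpow p a ^ n"
  by (induction n) (simp_all add: Xpow_add ring_distribs)

lemma norm_Xpow: "p > 0 \<Longrightarrow> norm (Xpow p a) = p powr (- Re a)"
  by (simp add: Xpow_def norm_powr_real_powr)

lemma norm_Xpow_less_1: "p > 1 \<Longrightarrow> Re a > 0 \<Longrightarrow> norm (Xpow p a) < 1"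
  by (simp add: norm_Xpow powr_less_one)

lemma norm_Xpow_gt_1: "p > 1 \<Longrightarrow> Re a < 0 \<Longrightarrow> norm (Xpow p a) > 1"
  by (simp add: norm_Xpow)

lemma finite_copies [simp]: "finite (copies A)"
  and prod_copies: "(\<Prod>c\<in>copies A. h (fst c)) = (\<Prod>a\<in>#A. (h a :: complex))"
proof -
  have eq: "copies A = Sigma (set_mset A) (\<lambda>a. {..<count A a})"
    by (auto simp: copies_def) (metis count_inI gr_implies_not0)
  show "finite (copies A)" by (simp add: eq)
  show "(\<Prod>c\<in>copies A. h (fst c)) = (\<Prod>a\<in>#A. h a)"
    using prod.Sigma[of "set_mset A" "\<lambda>a. {..<count A a}" "\<lambda>a _. h a"]
    by (simp add: eq image_prod_mset_multiplicity case_prod_unfold)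
qed

lemma fst_copies: "c \<in> copies A \<Longrightarrow> fst c \<in># A"
  by (auto simp: copies_def intro: count_inI)

lemma finite_coeff_tuples: "finite (coeff_tuples A (int n))"
proof (rule finite_subset)
  show "coeff_tuples A (int n) \<subseteq> copies A \<rightarrow>\<^sub>E {..n}"
  proof
    fix f assume f: "f \<in> coeff_tuples A (int n)"
    hence "(\<Sum>c\<in>copies A. f c) = n"
      by (simp add: coeff_tuples_def flip: of_nat_sum)
    hence "f c \<le> n" if "c \<in> copies A" for c
      using member_le_sum[OF that, of f] by auto
    thus "f \<in> copies A \<rightarrow>\<^sub>E {..n}" using f by (auto simp: coeff_tuples_def PiE_iff)
  qed
qed (simp add: finite_PiE)

section \<open>Geometric series and the generating function of the coefficients
  \<open>A(n)\<close>\<close>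

lemma geometric_abs_summable_has_sum:
  fixes x :: complex
  assumes "norm x < 1"
  shows "(\<lambda>n. x ^ n) abs_summable_on UNIV" "((\<lambda>n. x ^ n) has_sum 1 / (1 - x)) UNIV"
proof -
  have s: "summable (\<lambda>n. norm (x ^ n))"
    unfolding norm_power using assms by (intro summable_geometric) auto
  thus "(\<lambda>n. x ^ n) abs_summable_on UNIV"
    by (intro summable_nonneg_imp_summable_on) auto
  show "((\<lambda>n. x ^ n) has_sum 1 / (1 - x)) UNIV"
    by (intro norm_summable_imp_has_sum geometric_sums s assms)
qed

text \<open>Expanding one geometric series per copy of an element gives a sum over all exponent
  tuples; collecting the tuples of total degree \<open>n\<close> gives the coefficient of
  \<open>w ^ n\<close>. Absolute convergence of the product justifies the regrouping.\<close>

lemma mcoeff_generating_function: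
  assumes p: "p > 1" and w: "\<And>a. a \<in># A \<Longrightarrow> norm (Xpow p a * w) < 1"
  shows "(\<lambda>n. mcoeff p A (int n) * w ^ n) abs_summable_on UNIV"
    and "((\<lambda>n. mcoeff p A (int n) * w ^ n) has_sum (\<Prod>a\<in>#A. 1 / (1 - Xpow p a * w))) UNIV"
proof -
  define T where "T = (copies A \<rightarrow>\<^sub>E (UNIV :: nat set))"
  define S where "S = Sigma UNIV (\<lambda>n. coeff_tuples A (int n))"
  define h where "h f = (\<Prod>c\<in>copies A. (Xpow p (fst c) * w) ^ f c)" for f
  have geo: "(\<lambda>n. (Xpow p (fst c) * w) ^ n) abs_summable_on UNIV"
    "((\<lambda>n. (Xpow p (fst c) * w) ^ n) has_sum 1 / (1 - Xpow p (fst c) * w)) UNIV"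
    if "c \<in> copies A" for c
    using geometric_abs_summable_has_sum[OF w[OF fst_copies[OF that]]] by auto
  have hT: "h abs_summable_on T"
    unfolding h_def T_def by (rule abs_summable_on_prod_PiE) (use geo in auto)
  have "infsum h T = (\<Prod>c\<in>copies A. 1 / (1 - Xpow p (fst c) * w))"
    unfolding h_def T_def
    by (subst infsum_prod_PiE_abs) (use geo in \<open>auto intro!: prod.cong infsumI\<close>)
  also have "\<dots> = (\<Prod>a\<in>#A. 1 / (1 - Xpow p a * w))"
    by (rule prod_copies)
  finally have hT': "(h has_sum (\<Prod>a\<in>#A. 1 / (1 - Xpow p a * w))) T"
    using abs_summable_summable[OF hT] has_sum_infsum by metis
  \<comment> \<open>Each tuple has exactly one total degree, so attaching the degree neither loses
    nor repeats tuples.\<close>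
  have bij: "bij_betw snd S T"
    by (rule bij_betw_byWitness[of _ "\<lambda>f. (\<Sum>c\<in>copies A. f c, f)"])
       (auto simp: S_def T_def coeff_tuples_def simp flip: of_nat_sum)
  have hS: "(\<lambda>x. h (snd x)) abs_summable_on S"
    using hT by (subst summable_on_reindex_bij_betw[OF bij, of "\<lambda>f. norm (h f)"])
  have hS': "((\<lambda>x. h (snd x)) has_sum (\<Prod>a\<in>#A. 1 / (1 - Xpow p a * w))) S"
    using hT' by (subst has_sum_reindex_bij_betw[OF bij])
  have coeff: "mcoeff p A (int n) * w ^ n = (\<Sum>f\<in>coeff_tuples A (int n). h f)" for n
    unfolding mcoeff_def sum_distrib_right
  proof (rule sum.cong)
    fix f assume "f \<in> coeff_tuples A (int n)"
    hence "n = (\<Sum>c\<in>copies A. f c)" by (simp add: coeff_tuples_def flip: of_nat_sum)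
    thus "(\<Prod>c\<in>copies A. Xpow p (fst c * of_nat (f c))) * w ^ n = h f"
      using p by (simp add: h_def power_sum power_mult_distrib prod.distrib Xpow_of_nat_mult
          mult.commute[of _ "of_nat _"])
  qed simp
  show "((\<lambda>n. mcoeff p A (int n) * w ^ n) has_sum (\<Prod>a\<in>#A. 1 / (1 - Xpow p a * w))) UNIV"
    using hS' unfolding S_def
    by (rule has_sum_Sigma') (simp add: coeff has_sum_finite finite_coeff_tuples)
  have "(\<lambda>n. \<Sum>\<^sub>\<infinity>f\<in>coeff_tuples A (int n). norm (h f)) summable_on UNIV"
    using summable_on_SigmaD[OF hS[unfolded S_def]] by (simp add: finite_coeff_tuples)
  thus "(\<lambda>n. mcoeff p A (int n) * w ^ n) abs_summable_on UNIV"
    by (rule Infinite_Sum.abs_summable_on_comparison_test')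
       (simp add: coeff finite_coeff_tuples norm_sum)
qed

lemma mshift_generating_function:
  assumes p: "p > 1" and w: "\<And>a. a \<in># A \<Longrightarrow> norm (Xpow p (a + \<gamma>) * w) < 1"
  shows "(\<lambda>n. mcoeff p (mshift A \<gamma>) (int n) * w ^ n) abs_summable_on UNIV"
    and "((\<lambda>n. mcoeff p (mshift A \<gamma>) (int n) * w ^ n) has_sum
           (\<Prod>a\<in>#A. 1 / (1 - Xpow p (a + \<gamma>) * w))) UNIV"
  using mcoeff_generating_function[OF p, of "mshift A \<gamma>" w] w
  by (auto simp: mshift_def image_mset.compositionality o_def)

text \<open>These are the Laurent coefficients, on the unit circle, of
  \<open>(1 - P * R) / ((1 - P * z) * (1 - R / z))\<close> when \<open>P\<close> and
  \<open>R\<close> have norm below 1.\<close>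

definition two_sided :: "complex \<Rightarrow> complex \<Rightarrow> int \<Rightarrow> complex" where
  "two_sided P R c = (if c \<ge> 0 then P ^ nat c else R ^ nat (- c))"

text \<open>The nonnegative and the negative exponents give one geometric series each. In the sum of
  the two values the numerator is
  \<open>(1 - R / z) + (R / z) * (1 - P * z) = 1 - P * R\<close>.\<close>

lemma two_sided_generating_function:
  assumes P: "norm P < 1" and R: "norm R < 1" and z: "norm z = 1"
  shows "(\<lambda>c. two_sided P R c * z powi c) abs_summable_on UNIV" (is ?abs)
    and "((\<lambda>c. two_sided P R c * z powi c) has_sum
            (1 - P * R) * (1 / (1 - P * z)) * (1 / (1 - R / z))) UNIV" (is ?sum)
proof -
  note geo = geometric_abs_summable_has_sum
  have z0: "z \<noteq> 0" using z by auto
  define f where "f c = two_sided P R c * z powi c" for c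
  have l: "norm (P * z) < 1" "norm (R / z) < 1" using P R z by (auto simp: norm_mult norm_divide)
  have f1: "f (int n) = (P * z) ^ n" for n
    by (simp add: f_def two_sided_def power_mult_distrib)
  have f2: "f (- int n) = (R / z) ^ n" for n
    using z0 by (simp add: f_def two_sided_def power_divide power_int_minus divide_inverse
        power_mult_distrib power_inverse)
  have b1: "bij_betw int UNIV {0..}"
    by (rule bij_betw_byWitness[of _ nat]) auto
  \<comment> \<open>The second series starts at 1, so that exponent 0 is counted once only.\<close>
  have b2: "bij_betw (\<lambda>n. - int n) {1..} {..<0}"
    by (rule bij_betw_byWitness[of _ "\<lambda>c. nat (- c)"]) auto
  have U: "UNIV = {0..} \<union> {..<0::int}" by auto
  have "(\<lambda>n. f (int n)) abs_summable_on UNIV" using geo(1)[OF l(1)] by (simp add: f1)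
  hence a1: "f abs_summable_on {0..}"
    using summable_on_reindex_bij_betw[OF b1, of "\<lambda>c. norm (f c)"] by simp
  have "(\<lambda>n. f (- int n)) abs_summable_on {1..}"
    using summable_on_subset_banach[OF geo(1)[OF l(2)], of "{1..}"] by (simp add: f2)
  hence a2: "f abs_summable_on {..<0}"
    using summable_on_reindex_bij_betw[OF b2, of "\<lambda>c. norm (f c)"] by simp
  have s1: "(f has_sum 1 / (1 - P * z)) {0..}"
    using geo(2)[OF l(1)] has_sum_reindex_bij_betw[OF b1, of f] by (simp add: f1)
  have s2: "(f has_sum (R / z) / (1 - R / z)) {..<0}"
    using has_sum_geometric_from_1[OF l(2)] has_sum_reindex_bij_betw[OF b2, of f] by (simp add: f2)
  have "f abs_summable_on UNIV"
    unfolding U by (intro summable_on_Un_disjoint a1 a2) auto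
  thus ?abs by (simp add: f_def)
  have "P * z \<noteq> 1" "R / z \<noteq> 1" using l by auto
  hence "1 / (1 - P * z) + (R / z) / (1 - R / z) = (1 - P * R) * (1 / (1 - P * z)) * (1 / (1 - R / z))"
    using z0 by (auto simp: divide_simps) (simp_all add: algebra_simps)
  moreover have "(f has_sum 1 / (1 - P * z) + (R / z) / (1 - R / z)) UNIV"
    unfolding U by (intro has_sum_Un_disjoint s1 s2) auto
  ultimately show ?sum by (simp add: f_def[abs_def])
qed

subsection \<open>Evaluation of the local sums\<close>

text \<open>For fixed \<open>(a, b)\<close> the terms with \<open>q = 0\<close> run over
  \<open>d \<le> L a b\<close> and those with \<open>q = 1\<close>, of opposite sign, over
  \<open>d < L a b\<close>; only \<open>d = L a b\<close> survives. Absolute convergence rests on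
  \<open>2 * min u v \<le> u + v\<close>, which splits the growth in \<open>L a b\<close> into
  separate weights for \<open>f\<close> and \<open>g\<close>.\<close>

lemma abel_double_sum:
  fixes f g :: "nat \<Rightarrow> complex" and \<rho> :: complex and M N :: nat
  defines "L \<equiv> \<lambda>a b. min (a + N) (b + M)"
  defines "K \<equiv> \<lambda>(a, b). {(d, q). q \<in> {0, 1} \<and> d + q \<le> L a b}"
  defines "t \<equiv> \<lambda>((a, b), (d, q)). (- 1) ^ q * (\<rho>\<^sup>2) ^ d * (f a * g b)"
  assumes \<rho>: "norm \<rho> > 1"
    and f: "(\<lambda>a. f a * \<rho> ^ a) abs_summable_on UNIV"
    and g: "(\<lambda>b. g b * \<rho> ^ b) abs_summable_on UNIV"
  shows "t abs_summable_on Sigma UNIV K"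
    and "infsum t (Sigma UNIV K) = (\<Sum>\<^sub>\<infinity>(a, b)\<in>UNIV. f a * g b * (\<rho>\<^sup>2) ^ L a b)"
proof -
  have fibre: "K (a, b) = (\<lambda>d. (d, 0)) ` {..L a b} \<union> (\<lambda>d. (d, 1)) ` {..<L a b}" for a b
    by (auto simp: K_def)
  have fin: "finite (K x)" for x by (cases x) (simp add: fibre)
  have sum_K: "sum h (K (a, b)) = (\<Sum>d\<le>L a b. h (d, 0)) + (\<Sum>d<L a b. h (d, 1))"
    for h :: "nat \<times> nat \<Rightarrow> 'c::comm_monoid_add" and a b
    unfolding fibre by (subst sum.union_disjoint) (auto simp: sum.reindex inj_on_def)
  have fibre_sum: "(\<Sum>y\<in>K x. t (x, y)) = (case x of (a, b) \<Rightarrow> f a * g b * (\<rho>\<^sup>2) ^ L a b)" for x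
  proof (cases x)
    case (Pair a b)
    have "(\<Sum>y\<in>K (a, b). t ((a, b), y)) =
        (\<Sum>d\<le>L a b. (\<rho>\<^sup>2) ^ d * (f a * g b)) - (\<Sum>d<L a b. (\<rho>\<^sup>2) ^ d * (f a * g b))"
      by (simp add: sum_K t_def sum_negf)
    also have "\<dots> = f a * g b * (\<rho>\<^sup>2) ^ L a b"
      by (simp add: lessThan_Suc_atMost[symmetric])
    finally show ?thesis by (simp add: Pair)
  qed
  define s where "s = norm (\<rho>\<^sup>2)"
  have s: "s > 1" using \<rho> by (simp add: s_def norm_power)
  \<comment> \<open>The power of \<open>norm \<rho>\<close> comes from the shifts \<open>M\<close>
    and \<open>N\<close> in \<open>L\<close>, the factor 2 from the two values of \<open>q\<close>,
    and \<open>s / (s - 1)\<close> from the geometric sum over \<open>d\<close>.\<close>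
  define C where "C = norm \<rho> ^ (M + N) * (2 * s / (s - 1))"
  have bound: "(\<Sum>y\<in>K (a, b). norm (t ((a, b), y))) \<le>
      C * norm (f a * \<rho> ^ a * (g b * \<rho> ^ b))" for a b
  proof -
    have n: "norm (t ((a, b), (d, q))) = s ^ d * norm (f a * g b)" for d q
      by (simp add: t_def s_def norm_mult norm_power)
    have "(\<Sum>y\<in>K (a, b). norm (t ((a, b), y))) \<le> 2 * (\<Sum>d\<le>L a b. s ^ d * norm (f a * g b))"
      using s by (simp add: sum_K n lessThan_Suc_atMost[symmetric])
    also have "\<dots> = 2 * norm (f a * g b) * ((s ^ Suc (L a b) - 1) / (s - 1))"
      using s by (simp add: sum_distrib_right[symmetric] geometric_sum del: sum.lessThan_Suc
          flip: lessThan_Suc_atMost)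
    also have "\<dots> \<le> 2 * norm (f a * g b) * (s ^ Suc (L a b) / (s - 1))"
      using s by (intro mult_left_mono divide_right_mono) auto
    also have "\<dots> = norm (f a * g b) * (2 * s / (s - 1)) * s ^ L a b"
      by simp
    also have "s ^ L a b \<le> norm \<rho> ^ (a + N + (b + M))"
      unfolding s_def norm_power power_mult[symmetric]
      using \<rho> by (intro power_increasing) (simp_all add: L_def min_def)
    hence "norm (f a * g b) * (2 * s / (s - 1)) * s ^ L a b \<le>
      norm (f a * g b) * (2 * s / (s - 1)) * norm \<rho> ^ (a + N + (b + M))"
      using s by (intro mult_left_mono) auto
    also have "\<dots> = C * norm (f a * \<rho> ^ a * (g b * \<rho> ^ b))"
      by (simp add: C_def norm_mult norm_power power_add mult_ac)
    finally show ?thesis .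
  qed
  have "(\<lambda>x. C * norm (case x of (a, b) \<Rightarrow> f a * \<rho> ^ a * (g b * \<rho> ^ b))) summable_on UNIV"
    using abs_summable_on_times[OF f g] by (intro summable_on_cmult_right) simp
  hence "(\<lambda>x. \<Sum>y\<in>K x. norm (t (x, y))) summable_on UNIV"
  proof (rule summable_on_comparison_test)
    fix x show "(\<Sum>y\<in>K x. norm (t (x, y))) \<le> C * norm (case x of (a, b) \<Rightarrow> f a * \<rho> ^ a * (g b * \<rho> ^ b))"
      using bound[of "fst x" "snd x"] by (simp add: case_prod_unfold)
  qed (simp add: sum_nonneg)
  thus abs: "t abs_summable_on Sigma UNIV K"
    by (intro summable_on_SigmaI[where g = "\<lambda>x. \<Sum>y\<in>K x. norm (t (x, y))"]) (auto intro: has_sum_finite fin)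
  show "infsum t (Sigma UNIV K) = (\<Sum>\<^sub>\<infinity>(a, b)\<in>UNIV. f a * g b * (\<rho>\<^sup>2) ^ L a b)"
    using infsum_Sigma_banach[OF abs_summable_summable[OF abs]] by (simp add: fin fibre_sum)
qed

text \<open>Taking out the common power of \<open>P * R\<close> leaves a power of whichever of
  \<open>P\<close>, \<open>R\<close> has the larger exponent, and \<open>two_sided\<close> selects
  it by the sign of the difference.\<close>

lemma two_sided_diff:
  assumes "P \<noteq> 0" "R \<noteq> 0"
  shows "P ^ v * R ^ u = (P * R) ^ min u v * two_sided P R (int v - int u)"
proof (cases "u \<le> v")
  case True
  then obtain k where "v = u + k" by (auto simp: le_iff_add)
  thus ?thesis by (simp add: two_sided_def power_add power_mult_distrib)
next
  case False
  then obtain k where "u = v + k" "k > 0" by (metis less_imp_add_positive not_le)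
  thus ?thesis by (simp add: two_sided_def power_add power_mult_distrib)
qed

text \<open>This is the coefficient of \<open>z powi e\<close> in a product of three series: that of
  \<open>mshift A (- \<alpha>)\<close> in powers of \<open>z\<close>, that of
  \<open>mshift B (- \<beta>)\<close> in powers of \<open>1 / z\<close>, and a two-sided one. The
  condition \<open>c + a - b = e\<close> on the exponents forces
  \<open>c = e + b - a\<close>.\<close>

definition local_coeff ::
  "real \<Rightarrow> complex multiset \<Rightarrow> complex multiset \<Rightarrow> complex \<Rightarrow> complex \<Rightarrow> int \<Rightarrow> complex" where
  "local_coeff p A B \<alpha> \<beta> e = (\<Sum>\<^sub>\<infinity>(a, b)\<in>UNIV.
     mcoeff p (mshift A (- \<alpha>)) (int a) * Xpow p (1/2 + \<alpha>) ^ a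
     * (mcoeff p (mshift B (- \<beta>)) (int b) * Xpow p (1/2 + \<beta>) ^ b)
     * two_sided (Xpow p (1/2 - \<beta>)) (Xpow p (1/2 - \<alpha>)) (e + int b - int a))"

text \<open>Take the arguments \<open>a\<close>, \<open>b\<close> of the two coefficients as
  summation variables instead of \<open>j\<close>, \<open>k\<close>. Nonnegativity of
  \<open>j\<close> and \<open>k\<close> becomes \<open>d + q \<le> min (a + N) (b + M)\<close>, so
  the sum over \<open>d\<close> and \<open>q\<close> telescopes. The powers of \<open>P\<close> and
  \<open>R\<close> then cancel the surviving power of \<open>\<rho>\<^sup>2\<close>, and only
  \<open>M - N\<close> remains.\<close>

lemma Sigma_series_local_coeff:
  fixes p :: real
  assumes p: "p > 1"
    and A: "\<And>a. a \<in># A \<Longrightarrow> \<bar>Re a\<bar> \<le> 1 / 20" and B: "\<And>b. b \<in># B \<Longrightarrow> \<bar>Re b\<bar> \<le> 1 / 20"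
    and \<alpha>: "\<bar>Re \<alpha>\<bar> \<le> 1 / 20" and \<beta>: "\<bar>Re \<beta>\<bar> \<le> 1 / 20"
  shows "Sigma_term p A B \<alpha> \<beta> M N abs_summable_on Sigma_index" (is ?abs)
    and "Sigma_series p A B \<alpha> \<beta> M N * Xpow p (1/2 - \<beta>) ^ M * Xpow p (1/2 - \<alpha>) ^ N
       = local_coeff p A B \<alpha> \<beta> (int M - int N)" (is ?eq)
proof -
  \<comment> \<open>In terms of \<open>a\<close> and \<open>b\<close> the last exponent of
    \<open>Sigma_term\<close> is \<open>a + b - d\<close>. Hence \<open>d\<close> enters through the
    power \<open>d\<close> of \<open>Xpow p (\<alpha> + \<beta> - 1)\<close>, of which
    \<open>\<rho>\<close> is a square root.\<close>
  define \<rho> where "\<rho> = Xpow p ((\<alpha> + \<beta> - 1) / 2)"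
  define x where "x = Xpow p 1"
  define F where "F n = mcoeff p (mshift A (- \<alpha>)) (int n)" for n
  define G where "G n = mcoeff p (mshift B (- \<beta>)) (int n)" for n
  define f where "f n = F n * x ^ n" for n
  define g where "g n = G n * x ^ n" for n
  have \<rho>: "norm \<rho> > 1" unfolding \<rho>_def using \<alpha> \<beta> p by (intro norm_Xpow_gt_1) auto
  have abs1: "(\<lambda>n. f n * \<rho> ^ n) abs_summable_on UNIV"
  proof -
    \<comment> \<open>The exponent has real part at least \<open>1/2 - 1/20 - 1/40 - 1/40\<close>,
      which is positive.\<close>
    have "norm (Xpow p (a + - \<alpha>) * (x * \<rho>)) < 1" if a: "a \<in># A" for a
    proof -
      have "Re (a + - \<alpha> + (1 + (\<alpha> + \<beta> - 1) / 2)) = Re a + Re \<beta> / 2 - Re \<alpha> / 2 + 1 / 2"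
        by (simp add: field_simps)
      also have "\<dots> > 0" using \<alpha> \<beta> A[OF a] by linarith
      finally show ?thesis
        unfolding x_def \<rho>_def Xpow_add[symmetric] using p by (intro norm_Xpow_less_1)
    qed
    from mshift_generating_function(1)[OF p this] show ?thesis
      by (simp add: f_def F_def power_mult_distrib mult_ac)
  qed
  have abs2: "(\<lambda>n. g n * \<rho> ^ n) abs_summable_on UNIV"
  proof -
    have "norm (Xpow p (a + - \<beta>) * (x * \<rho>)) < 1" if a: "a \<in># B" for a
    proof -
      have "Re (a + - \<beta> + (1 + (\<alpha> + \<beta> - 1) / 2)) = Re a + Re \<alpha> / 2 - Re \<beta> / 2 + 1 / 2"
        by (simp add: field_simps)
      also have "\<dots> > 0" using \<alpha> \<beta> B[OF a] by linarith
      finally show ?thesis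
        unfolding x_def \<rho>_def Xpow_add[symmetric] using p by (intro norm_Xpow_less_1)
    qed
    from mshift_generating_function(1)[OF p this] show ?thesis
      by (simp add: g_def G_def power_mult_distrib mult_ac)
  qed
  define K where "K = (\<lambda>(a, b). {(d, q). q \<in> {0, 1 :: nat} \<and> d + q \<le> min (a + N) (b + M)})"
  define t where "t = (\<lambda>((a, b), (d, q :: nat)). (- 1) ^ q * (\<rho>\<^sup>2) ^ d * (f a * g b))"
  \<comment> \<open>On \<open>Sigma UNIV K\<close> the subtractions from \<open>a\<close> and
    \<open>b\<close> do not truncate, because \<open>q + d \<le> a + N\<close> and
    \<open>q + d \<le> b + M\<close>.\<close>
  define i where "i = (\<lambda>((a, b), (d, q)). (d, a - (q + d - min (q + d) N), b - (q + d - min (q + d) M), q))"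
  define j where "j = (\<lambda>(d, j, k, q). ((j + (q + d - min (q + d) N), k + (q + d - min (q + d) M)), (d, q :: nat)))"
  have ij: "i (j y) = y" "j y \<in> Sigma UNIV K" if "y \<in> Sigma_index" for y
    using that by (auto simp: i_def j_def K_def Sigma_index_def)
  have ji: "j (i y) = y" "i y \<in> Sigma_index" if "y \<in> Sigma UNIV K" for y
    using that by (auto simp: i_def j_def K_def Sigma_index_def)
  have t: "t (j y) = Sigma_term p A B \<alpha> \<beta> M N y" for y
  proof -
    obtain d j' k q where y: "y = (d, j', k, q)" by (cases y) auto
    define a where "a = j' + (q + d - min (q + d) N)"
    define b where "b = k + (q + d - min (q + d) M)"
    have 1: "int j' + int q + int d - int (min (q + d) N) = int a"
      "int k + int q + int d - int (min (q + d) M) = int b"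
      "2 * int q + int d + int j' + int k - int (min (q + d) M) - int (min (q + d) N) = int a + int b - int d"
      by (auto simp: a_def b_def)
    have 2: "(\<rho>\<^sup>2) ^ d * x ^ a * x ^ b =
        Xpow p (of_nat d * (\<alpha> + \<beta>)) * Xpow p (of_int (int a + int b - int d))"
    proof -
      have "\<rho>\<^sup>2 = Xpow p (\<alpha> + \<beta> - 1)"
        unfolding \<rho>_def power2_eq_square Xpow_add[symmetric] by (rule arg_cong) (simp add: field_simps)
      thus ?thesis using p
        by (simp add: x_def Xpow_of_nat_mult[symmetric] Xpow_add[symmetric] algebra_simps)
    qed
    have "j y = ((a, b), (d, q))" by (simp add: y j_def a_def b_def)
    hence "t (j y) = (- 1) ^ q * ((\<rho>\<^sup>2) ^ d * x ^ a * x ^ b) * F a * G b"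
      by (simp add: t_def f_def g_def)
    also have "\<dots> = Sigma_term p A B \<alpha> \<beta> M N y"
      unfolding y Sigma_term_def prod.case 1 2 by (simp add: F_def G_def)
    finally show ?thesis .
  qed
  note abel = abel_double_sum[OF \<rho> abs1 abs2, where M = M and N = N, folded K_def t_def]
  have "(\<lambda>y. norm (Sigma_term p A B \<alpha> \<beta> M N y)) summable_on Sigma_index \<longleftrightarrow>
      (\<lambda>y. norm (t y)) summable_on Sigma UNIV K"
    by (rule summable_on_reindex_bij_witness[of _ i j]) (auto simp: ij ji t)
  with abel(1) show ?abs by simp
  define P where "P = Xpow p (1/2 - \<beta>)"
  define R where "R = Xpow p (1/2 - \<alpha>)"
  define U where "U = Xpow p (1/2 + \<alpha>)"
  define V where "V = Xpow p (1/2 + \<beta>)"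
  have nz: "P \<noteq> 0" "R \<noteq> 0" using p by (auto simp: P_def R_def)
  \<comment> \<open>Splitting \<open>x\<close> differently for \<open>a\<close> and for
    \<open>b\<close> turns the weights into \<open>R ^ (a + N)\<close> and
    \<open>P ^ (b + M)\<close>, with exponents matching the two arguments of the minimum.\<close>
  have x: "x = U * R" "x = V * P"
    by (simp_all add: x_def U_def V_def P_def R_def flip: Xpow_add)
  have "\<rho>\<^sup>2 * (P * R) = 1"
    using p unfolding \<rho>_def P_def R_def power2_eq_square Xpow_add[symmetric] by (simp add: field_simps)
  hence cancel: "(\<rho>\<^sup>2) ^ n * (P * R) ^ n = 1" for n
    by (simp add: power_mult_distrib[symmetric])
  have term_eq: "f a * g b * (\<rho>\<^sup>2) ^ min (a + N) (b + M) * (P ^ M * R ^ N) =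
    F a * U ^ a * (G b * V ^ b) * two_sided P R (int M - int N + int b - int a)" for a b
  proof -
    have "f a * g b * (\<rho>\<^sup>2) ^ min (a + N) (b + M) * (P ^ M * R ^ N) =
        F a * U ^ a * (G b * V ^ b) * ((\<rho>\<^sup>2) ^ min (a + N) (b + M) * (P ^ (b + M) * R ^ (a + N)))"
      unfolding f_def g_def by (subst x(1), subst x(2)) (simp add: power_mult_distrib power_add)
    also have "P ^ (b + M) * R ^ (a + N) = (P * R) ^ min (a + N) (b + M)
        * two_sided P R (int (b + M) - int (a + N))"
      by (rule two_sided_diff) fact+
    also have "(\<rho>\<^sup>2) ^ min (a + N) (b + M) * ((P * R) ^ min (a + N) (b + M)
        * two_sided P R (int (b + M) - int (a + N))) = two_sided P R (int (b + M) - int (a + N))"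
      by (simp add: mult.assoc[symmetric] cancel)
    also have "int (b + M) - int (a + N) = int M - int N + int b - int a" by simp
    finally show ?thesis .
  qed
  have "Sigma_series p A B \<alpha> \<beta> M N = infsum t (Sigma UNIV K)"
    unfolding Sigma_series_def by (rule infsum_reindex_bij_witness[of _ i j]) (auto simp: ij ji t)
  hence "Sigma_series p A B \<alpha> \<beta> M N * P ^ M * R ^ N
      = (\<Sum>\<^sub>\<infinity>(a, b)\<in>UNIV. f a * g b * (\<rho>\<^sup>2) ^ min (a + N) (b + M)) * (P ^ M * R ^ N)"
    using abel(2) by simp
  also have "\<dots> = (\<Sum>\<^sub>\<infinity>(a, b)\<in>UNIV. f a * g b * (\<rho>\<^sup>2) ^ min (a + N) (b + M) * (P ^ M * R ^ N))"
    by (simp add: infsum_cmult_left'[symmetric] case_prod_unfold)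
  also have "\<dots> = local_coeff p A B \<alpha> \<beta> (int M - int N)"
    unfolding term_eq by (simp add: local_coeff_def F_def G_def U_def V_def P_def R_def)
  finally show ?eq by (simp add: P_def R_def)
qed

text \<open>On the unit circle the three series converge absolutely and may be multiplied and sorted
  by total exponent. The weights \<open>U\<close> and \<open>V\<close> undo the shifts of
  \<open>A\<close> and \<open>B\<close>, and the denominators of the two-sided series supply the
  extra elements \<open>- \<beta>\<close> and \<open>- \<alpha>\<close>.\<close>

lemma local_coeff_generating_function:
  fixes p :: real
  assumes p: "p > 1"
    and A: "\<And>a. a \<in># A \<Longrightarrow> \<bar>Re a\<bar> \<le> 1 / 20" and B: "\<And>b. b \<in># B \<Longrightarrow> \<bar>Re b\<bar> \<le> 1 / 20"
    and \<alpha>: "\<bar>Re \<alpha>\<bar> \<le> 1 / 20" and \<beta>: "\<bar>Re \<beta>\<bar> \<le> 1 / 20" and z: "norm z = 1"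
  defines "s \<equiv> Xpow p (1/2)"
  shows "(\<lambda>e. local_coeff p A B \<alpha> \<beta> e * z powi e) abs_summable_on UNIV" (is ?abs)
    and "((\<lambda>e. local_coeff p A B \<alpha> \<beta> e * z powi e) has_sum
      (1 - Xpow p (1 - \<alpha> - \<beta>))
      * (\<Prod>a\<in>#A + {#- \<beta>#}. 1 / (1 - Xpow p a * (s * z)))
      * (\<Prod>b\<in>#B + {#- \<alpha>#}. 1 / (1 - Xpow p b * (s / z)))) UNIV" (is ?sum)
proof -
  have z0: "z \<noteq> 0" using z by auto
  define P where "P = Xpow p (1/2 - \<beta>)"
  define R where "R = Xpow p (1/2 - \<alpha>)"
  define U where "U = Xpow p (1/2 + \<alpha>)"
  define V where "V = Xpow p (1/2 + \<beta>)"
  define F where "F n = mcoeff p (mshift A (- \<alpha>)) (int n) * U ^ n" for n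
  define G where "G n = mcoeff p (mshift B (- \<beta>)) (int n) * V ^ n" for n
  have F: "(\<lambda>n. F n * z ^ n) abs_summable_on UNIV"
    "((\<lambda>n. F n * z ^ n) has_sum (\<Prod>a\<in>#A. 1 / (1 - Xpow p a * (s * z)))) UNIV"
  proof -
    have shift: "Xpow p (a + - \<alpha>) * (U * z) = Xpow p a * (s * z)" for a
    proof -
      have "Xpow p (a + - \<alpha>) * U = Xpow p a * s"
        by (simp add: U_def s_def flip: Xpow_add)
      thus ?thesis by (metis divide_inverse mult.assoc)
    qed
    have "norm (Xpow p (a + - \<alpha>) * (U * z)) < 1" if a: "a \<in># A" for a
    proof -
      have "norm (Xpow p a * s) < 1"
        unfolding s_def Xpow_add[symmetric] using p A[OF a] by (intro norm_Xpow_less_1) auto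
      thus ?thesis unfolding shift using z by (simp add: norm_mult norm_divide)
    qed
    note gf = mshift_generating_function[OF p this]
    show "(\<lambda>n. F n * z ^ n) abs_summable_on UNIV"
      using gf(1) by (simp add: F_def power_mult_distrib mult_ac)
    show "((\<lambda>n. F n * z ^ n) has_sum (\<Prod>a\<in>#A. 1 / (1 - Xpow p a * (s * z)))) UNIV"
      using gf(2) unfolding shift by (simp add: F_def power_mult_distrib mult.assoc)
  qed
  have G: "(\<lambda>n. G n * inverse z ^ n) abs_summable_on UNIV"
    "((\<lambda>n. G n * inverse z ^ n) has_sum (\<Prod>b\<in>#B. 1 / (1 - Xpow p b * (s / z)))) UNIV"
  proof -
    have shift: "Xpow p (b + - \<beta>) * (V * inverse z) = Xpow p b * (s / z)" for b
    proof -
      have "Xpow p (b + - \<beta>) * V = Xpow p b * s"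
        by (simp add: V_def s_def flip: Xpow_add)
      thus ?thesis by (metis divide_inverse mult.assoc)
    qed
    have "norm (Xpow p (b + - \<beta>) * (V * inverse z)) < 1" if b: "b \<in># B" for b
    proof -
      have "norm (Xpow p b * s) < 1"
        unfolding s_def Xpow_add[symmetric] using p B[OF b] by (intro norm_Xpow_less_1) auto
      thus ?thesis unfolding shift using z by (simp add: norm_mult norm_divide)
    qed
    note gf = mshift_generating_function[OF p this]
    show "(\<lambda>n. G n * inverse z ^ n) abs_summable_on UNIV"
      using gf(1) by (simp add: G_def power_mult_distrib mult_ac)
    show "((\<lambda>n. G n * inverse z ^ n) has_sum (\<Prod>b\<in>#B. 1 / (1 - Xpow p b * (s / z)))) UNIV"
      using gf(2) unfolding shift by (simp add: G_def power_mult_distrib mult.assoc del: power_inverse)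
  qed
  have "norm P < 1" "norm R < 1"
    unfolding P_def R_def using p \<alpha> \<beta> by (auto intro!: norm_Xpow_less_1)
  note ts = two_sided_generating_function[OF this z]
  note FG = abs_summable_on_times[OF F(1) G(1)] has_sum_times[OF F G]
  note total = abs_summable_on_times[OF ts(1) FG(1)] has_sum_times[OF ts FG]
  define h where "h = (\<lambda>(c, (a, b)). two_sided P R c * z powi c *
     (case (a, b) of (a, b) \<Rightarrow> F a * z ^ a * (G b * inverse z ^ b)))"
  \<comment> \<open>The substitution replaces the index of the two-sided series by the total
    exponent \<open>e\<close>, so that each fibre sum is a multiple of
    \<open>local_coeff\<close>.\<close>
  define k where "k = (\<lambda>(e, (a, b)). (e + int b - int a, (a, b)))"
  have bij: "bij_betw k (Sigma UNIV (\<lambda>_. UNIV)) (UNIV \<times> (UNIV \<times> UNIV))"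
    by (rule bij_betw_byWitness[of _ "\<lambda>(c, (a, b)). (c + int a - int b, (a, b))"]) (auto simp: k_def)
  have hk: "h (k (e, (a, b))) = F a * G b * two_sided P R (e + int b - int a) * z powi e" for e a b
    using z0 by (simp add: h_def k_def power_int_add power_int_diff power_inverse field_simps)
  have abs: "(\<lambda>x. h (k x)) abs_summable_on Sigma UNIV (\<lambda>_. UNIV)"
    using total(1) unfolding h_def[symmetric]
    by (subst summable_on_reindex_bij_betw[OF bij, of "\<lambda>x. norm (h x)"]) (simp add: h_def case_prod_unfold)
  have inner: "((\<lambda>y. h (k (e, y))) has_sum local_coeff p A B \<alpha> \<beta> e * z powi e) UNIV" for e
  proof -
    have "(\<lambda>y. h (k (e, y))) summable_on UNIV"
      by (rule summable_on_SigmaD1[of "\<lambda>x y. h (k (x, y))" UNIV])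
        (use abs_summable_summable[OF abs] in \<open>simp_all add: case_prod_unfold\<close>)
    moreover have "(\<Sum>\<^sub>\<infinity>y. h (k (e, y))) = local_coeff p A B \<alpha> \<beta> e * z powi e"
      unfolding local_coeff_def infsum_cmult_left'[symmetric]
      by (rule infsum_cong) (auto simp: hk F_def G_def U_def V_def P_def R_def)
    ultimately show ?thesis by (metis has_sum_infsum)
  qed
  have innerN: "(\<lambda>y. norm (h (k (e, y)))) summable_on UNIV" for e
    by (rule summable_on_SigmaD1[of "\<lambda>x y. norm (h (k (x, y)))" UNIV])
      (use abs in \<open>simp_all add: case_prod_unfold\<close>)
  have "(\<lambda>e. \<Sum>\<^sub>\<infinity>y. norm (h (k (e, y)))) summable_on UNIV"
    using summable_on_SigmaD[OF abs innerN] .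
  thus ?abs
    by (rule Infinite_Sum.abs_summable_on_comparison_test')
       (use infsumI[OF inner] norm_infsum_bound[OF innerN] in simp)
  have "((\<lambda>x. h (k x)) has_sum (1 - P * R) * (1 / (1 - P * z)) * (1 / (1 - R / z)) *
      ((\<Prod>a\<in>#A. 1 / (1 - Xpow p a * (s * z))) * (\<Prod>b\<in>#B. 1 / (1 - Xpow p b * (s / z)))))
      (Sigma UNIV (\<lambda>_. UNIV))"
    using total(2) unfolding h_def[symmetric]
    by (subst has_sum_reindex_bij_betw[OF bij]) (simp add: h_def case_prod_unfold)
  from has_sum_Sigma'[OF this inner]
  have "((\<lambda>e. local_coeff p A B \<alpha> \<beta> e * z powi e) has_sum
     (1 - P * R) * (1 / (1 - P * z)) * (1 / (1 - R / z)) *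
      ((\<Prod>a\<in>#A. 1 / (1 - Xpow p a * (s * z))) * (\<Prod>b\<in>#B. 1 / (1 - Xpow p b * (s / z))))) UNIV" .
  moreover have "P * R = Xpow p (1 - \<alpha> - \<beta>)"
    unfolding P_def R_def Xpow_add[symmetric] by (rule arg_cong) simp
  moreover have "P = Xpow p (- \<beta>) * s" "R = Xpow p (- \<alpha>) * s"
    by (simp_all add: P_def R_def s_def flip: Xpow_add)
  ultimately show ?sum by (simp add: mult_ac)
qed

subsection \<open>The product formula\<close>

lemma prod_mset_image_sum:
  fixes h :: "'b \<Rightarrow> 'c::comm_monoid_mult"
  shows "(\<Prod>a\<in>#(\<Sum>j\<in>J. C j). h a) = (\<Prod>j\<in>J. \<Prod>a\<in>#C j. h a)"
  by (induction J rule: infinite_finite_induct) auto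

lemma powi_sum:
  fixes z :: complex
  assumes "z \<noteq> 0"
  shows "z powi (\<Sum>j\<in>J. e j) = (\<Prod>j\<in>J. z powi e j)"
  using assms by (induction J rule: infinite_finite_induct) (auto simp: power_int_add)

theorem theorem2:
  fixes p :: real and l :: nat
    and A B :: "nat \<Rightarrow> complex multiset"
    and \<alpha> \<beta> :: "nat \<Rightarrow> complex"
  assumes "p > 1" and "l \<ge> 1"
    and "\<And>j a. j \<in> {1..l} \<Longrightarrow> a \<in># A j \<Longrightarrow> \<bar>Re a\<bar> \<le> 1 / 20"
    and "\<And>j b. j \<in> {1..l} \<Longrightarrow> b \<in># B j \<Longrightarrow> \<bar>Re b\<bar> \<le> 1 / 20"
    and "\<And>j. j \<in> {1..l} \<Longrightarrow> \<bar>Re (\<alpha> j)\<bar> \<le> 1 / 20"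
    and "\<And>j. j \<in> {1..l} \<Longrightarrow> \<bar>Re (\<beta> j)\<bar> \<le> 1 / 20"
  shows "let A' = (\<Sum>j=1..l. A j) + (\<Sum>j=1..l. {#- \<beta> j#});
             B' = (\<Sum>j=1..l. B j) + (\<Sum>j=1..l. {#- \<alpha> j#})
         in (\<forall>j\<in>{1..l}. \<forall>M N.
               (\<lambda>x. norm (Sigma_term p (A j) (B j) (\<alpha> j) (\<beta> j) M N x)) summable_on Sigma_index)
          \<and> (\<lambda>x. norm (Q_term p l A B \<alpha> \<beta> x)) summable_on (Q_index l)
          \<and> (\<lambda>M. norm (C_term p A' B' M)) summable_on UNIV
          \<and> Q_series p l A B \<alpha> \<beta> = (\<Prod>j=1..l. (1 - Xpow p (1 - \<alpha> j - \<beta> j))) * C_series p A' B'"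
proof -
  note p = assms(1) and bounds = assms(3-6)
  define A' where "A' = (\<Sum>j=1..l. A j) + (\<Sum>j=1..l. {#- \<beta> j#})"
  define B' where "B' = (\<Sum>j=1..l. B j) + (\<Sum>j=1..l. {#- \<alpha> j#})"
  \<comment> \<open>Grouped by \<open>j\<close>, the product over \<open>A'\<close> has exactly the
    factors of the \<open>j\<close>-th local generating function, and likewise for
    \<open>B'\<close>.\<close>
  have A': "A' = (\<Sum>j=1..l. A j + {#- \<beta> j#})" and B': "B' = (\<Sum>j=1..l. B j + {#- \<alpha> j#})"
    unfolding A'_def B'_def by (simp_all only: sum.distrib)
  define s where "s = Xpow p (1/2)"
  have s0: "s \<noteq> 0" using p by (simp add: s_def)

  \<comment> \<open>Generating functions of \<open>A'\<close> and \<open>B'\<close>, with the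
    right-hand side as a constant term\<close>
  define c where "c = (\<Prod>j=1..l. (1 - Xpow p (1 - \<alpha> j - \<beta> j)))"
  define S where "S j = local_coeff p (A j) (B j) (\<alpha> j) (\<beta> j)" for j
  define F where "F D n = mcoeff p D (int n) * s ^ n" for D n
  define G where "G D z = (\<Prod>a\<in>#D. 1 / (1 - Xpow p a * (s * z)))" for D z
  have F: "(\<lambda>n. F D n * z ^ n) abs_summable_on UNIV" "((\<lambda>n. F D n * z ^ n) has_sum G D z) UNIV"
    if D: "D \<in> {A', B'}" and z: "norm z = 1" for D z
  proof -
    have "norm (Xpow p a * (s * z)) < 1" if a: "a \<in># D" for a
    proof -
      have "\<bar>Re a\<bar> \<le> 1 / 20" using a D bounds by (auto simp: A' B' set_mset_sum)
      hence "norm (Xpow p a * s) < 1"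
        unfolding s_def Xpow_add[symmetric] using p by (intro norm_Xpow_less_1) auto
      thus ?thesis using z by (simp add: norm_mult)
    qed
    note gf = mcoeff_generating_function[OF p this]
    show "(\<lambda>n. F D n * z ^ n) abs_summable_on UNIV"
      using gf(1) by (simp add: F_def power_mult_distrib mult.assoc)
    show "((\<lambda>n. F D n * z ^ n) has_sum G D z) UNIV"
      using gf(2) by (simp add: F_def G_def power_mult_distrib mult.assoc)
  qed
  note FA = F[OF insertI1] and FB = F[OF insertI2[OF singletonI]]
  \<comment> \<open>With exponent \<open>m - n\<close> attached to \<open>(m, n)\<close>, this
    family is the expansion of \<open>c * G A' z * G B' (1 / z)\<close>; its constant term is the
    diagonal sum.\<close>
  define g where "g = (\<lambda>(m, n). c * (F A' m * F B' n))"
  have FAB: "(\<lambda>(m, n). F A' m * F B' n) abs_summable_on UNIV"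
    using abs_summable_on_times[OF FA(1)[of 1] FB(1)[of 1]] by simp
  have g_abs: "g abs_summable_on UNIV"
    using summable_on_cmult_right[OF FAB, of "norm c"] by (simp add: g_def norm_mult case_prod_unfold)
  have g_sum: "(\<Sum>\<^sub>\<infinity>x\<in>UNIV. g x * z powi (int (fst x) - int (snd x))) = c * G A' z * G B' (1 / z)"
    if z: "norm z = 1" for z
  proof -
    have z0: "z \<noteq> 0" using z by auto
    have z': "norm (1 / z) = 1" using z by (simp add: norm_divide)
    have "((\<lambda>x. c * (case x of (m, n) \<Rightarrow> F A' m * z ^ m * (F B' n * (1 / z) ^ n)))
        has_sum c * (G A' z * G B' (1 / z))) UNIV"
      using has_sum_times[OF FA[OF z] FB[OF z']] by (intro has_sum_cmult_right) simp
    moreover have "c * (case x of (m, n) \<Rightarrow> F A' m * z ^ m * (F B' n * (1 / z) ^ n)) =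
        g x * z powi (int (fst x) - int (snd x))" for x
      using z0 by (simp add: g_def case_prod_unfold power_int_diff power_divide)
    ultimately show ?thesis by (simp add: infsumI mult.assoc)
  qed
  \<comment> \<open>The weight in \<open>C_term\<close> is shared equally: each factor receives
    \<open>s ^ m\<close>, with \<open>s\<close> a square root of \<open>Xpow p 1\<close>.\<close>
  have diag: "C_term p A' B' m = F A' m * F B' m" for m
  proof -
    have "Xpow p (of_nat m) = Xpow p 1 ^ m" using p Xpow_of_nat_mult[of p m 1] by simp
    also have "Xpow p 1 = s * s" by (simp add: s_def flip: Xpow_add)
    finally have "Xpow p (of_nat m) = s ^ m * s ^ m" by (simp add: power_mult_distrib)
    thus ?thesis by (simp add: C_term_def F_def)
  qed
  have bij_diag: "bij_betw (\<lambda>m. (m, m)) UNIV {x\<in>UNIV. int (fst x) - int (snd x) = 0}"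
    by (rule bij_betw_byWitness[of _ fst]) auto
  have C_abs: "C_term p A' B' abs_summable_on UNIV"
  proof -
    have "(\<lambda>m. norm (case (m, m) of (m, n) \<Rightarrow> F A' m * F B' n)) summable_on UNIV"
      using summable_on_reindex_bij_betw[OF bij_diag, of "\<lambda>x. norm (case x of (m, n) \<Rightarrow> F A' m * F B' n)"]
        summable_on_subset_banach[OF FAB] by simp
    thus ?thesis by (simp add: diag)
  qed
  have g_const: "infsum g {x\<in>UNIV. int (fst x) - int (snd x) = 0} = c * C_series p A' B'"
    unfolding C_series_def infsum_cmult_right'[symmetric] diag
    by (subst infsum_reindex_bij_betw[OF bij_diag, symmetric]) (simp add: g_def)

  \<comment> \<open>The product of the local generating functions\<close>
  define I where "I = Pi\<^sub>E {1..l} (\<lambda>_. UNIV :: int set)"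
  define f where "f e = (\<Prod>j=1..l. S j (e j))" for e
  have S: "(\<lambda>e. S j e * z powi e) abs_summable_on UNIV"
    "((\<lambda>e. S j e * z powi e) has_sum (1 - Xpow p (1 - \<alpha> j - \<beta> j))
      * (\<Prod>a\<in>#A j + {#- \<beta> j#}. 1 / (1 - Xpow p a * (s * z)))
      * (\<Prod>b\<in>#B j + {#- \<alpha> j#}. 1 / (1 - Xpow p b * (s / z)))) UNIV"
    if "j \<in> {1..l}" "norm z = 1" for j z
    unfolding S_def s_def
    by (rule local_coeff_generating_function; use p bounds that in blast)+
  have f_abs: "f abs_summable_on I"
    unfolding f_def I_def using S(1)[where z = 1] by (intro abs_summable_on_prod_PiE) auto
  have f_sum: "(\<Sum>\<^sub>\<infinity>e\<in>I. f e * z powi (\<Sum>j=1..l. e j)) = c * G A' z * G B' (1 / z)"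
    if z: "norm z = 1" for z
  proof -
    have "(\<Sum>\<^sub>\<infinity>e\<in>I. f e * z powi (\<Sum>j=1..l. e j)) = (\<Sum>\<^sub>\<infinity>e\<in>I. \<Prod>j=1..l. S j (e j) * z powi e j)"
      using z by (subst powi_sum) (auto simp: f_def prod.distrib)
    also have "\<dots> = (\<Prod>j=1..l. \<Sum>\<^sub>\<infinity>e. S j e * z powi e)"
      unfolding I_def using S(1)[OF _ z] by (intro infsum_prod_PiE_abs) auto
    also have "\<dots> = (\<Prod>j=1..l. (1 - Xpow p (1 - \<alpha> j - \<beta> j))
      * (\<Prod>a\<in>#A j + {#- \<beta> j#}. 1 / (1 - Xpow p a * (s * z)))
      * (\<Prod>b\<in>#B j + {#- \<alpha> j#}. 1 / (1 - Xpow p b * (s / z))))"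
      by (intro prod.cong refl infsumI S(2) z)
    also have "\<dots> = c * G A' z * G B' (1 / z)"
      unfolding G_def A' B' prod_mset_image_sum c_def prod.distrib by simp
    finally show ?thesis .
  qed
  \<comment> \<open>Both families have the same values on the unit circle, so their constant terms
    agree.\<close>
  have const: "infsum f {e\<in>I. (\<Sum>j=1..l. e j) = 0} = c * C_series p A' B'"
    unfolding g_const[symmetric]
    by (rule constant_term_eqI[OF f_abs g_abs]) (simp only: f_sum g_sum)

  \<comment> \<open>From integer exponents back to the pairs \<open>(M, N)\<close>\<close>
  define \<phi> where "\<phi> = (\<lambda>(M, N). \<lambda>j\<in>{1..l}. int (M j :: nat) - int (N j))"
  \<comment> \<open>The condition \<open>min (M j) (N j) = 0\<close> says that \<open>M j\<close>
    and \<open>N j\<close> are the positive and negative parts of their difference, which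
    \<open>nat\<close> recovers by truncation. Equality of the sums of \<open>M\<close> and
    \<open>N\<close> becomes total exponent 0.\<close>
  have bij: "bij_betw \<phi> (Q_index l) {e\<in>I. (\<Sum>j=1..l. e j) = 0}"
  proof (rule bij_betw_byWitness[of _ "\<lambda>e. (\<lambda>j\<in>{1..l}. nat (e j), \<lambda>j\<in>{1..l}. nat (- e j))"])
    show "\<forall>x\<in>Q_index l. ((\<lambda>j\<in>{1..l}. nat (\<phi> x j)), (\<lambda>j\<in>{1..l}. nat (- \<phi> x j))) = x"
    proof
      fix x assume x: "x \<in> Q_index l"
      obtain M N where xMN: "x = (M, N)" by (cases x)
      from x have MN: "M \<in> {1..l} \<rightarrow>\<^sub>E UNIV" "N \<in> {1..l} \<rightarrow>\<^sub>E UNIV" "\<And>j. j \<in> {1..l} \<Longrightarrow> min (M j) (N j) = 0"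
        by (auto simp: Q_index_def xMN)
      have "(\<lambda>j\<in>{1..l}. nat (\<phi> (M, N) j)) = M"
        by (rule PiE_ext[OF _ MN(1)]) (use MN(3) in \<open>fastforce simp: \<phi>_def min_def split: if_splits\<close>)+
      moreover have "(\<lambda>j\<in>{1..l}. nat (- \<phi> (M, N) j)) = N"
        by (rule PiE_ext[OF _ MN(2)]) (use MN(3) in \<open>fastforce simp: \<phi>_def min_def split: if_splits\<close>)+
      ultimately show "((\<lambda>j\<in>{1..l}. nat (\<phi> x j)), (\<lambda>j\<in>{1..l}. nat (- \<phi> x j))) = x"
        by (simp add: xMN)
    qed
  next
    show "\<forall>e\<in>{e\<in>I. (\<Sum>j=1..l. e j) = 0}.
        \<phi> ((\<lambda>j\<in>{1..l}. nat (e j)), (\<lambda>j\<in>{1..l}. nat (- e j))) = e"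
      by (auto simp: I_def \<phi>_def intro!: PiE_ext)
  next
    show "\<phi> ` Q_index l \<subseteq> {e\<in>I. (\<Sum>j=1..l. e j) = 0}"
      by (auto simp: I_def \<phi>_def Q_index_def sum_subtractf simp flip: of_nat_sum)
  next
    show "(\<lambda>e. ((\<lambda>j\<in>{1..l}. nat (e j)), (\<lambda>j\<in>{1..l}. nat (- e j)))) ` {e\<in>I. (\<Sum>j=1..l. e j) = 0} \<subseteq> Q_index l"
    proof (rule image_subsetI)
      fix e assume "e \<in> {e\<in>I. (\<Sum>j=1..l. e j) = 0}"
      hence e: "(\<Sum>j=1..l. e j) = 0" by simp
      have "int (\<Sum>j=1..l. nat (e j)) - int (\<Sum>j=1..l. nat (- e j)) = (\<Sum>j=1..l. e j)"
        unfolding of_nat_sum sum_subtractf[symmetric] by (rule sum.cong) auto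
      hence "(\<Sum>j=1..l. nat (e j)) = (\<Sum>j=1..l. nat (- e j))" using e by linarith
      thus "((\<lambda>j\<in>{1..l}. nat (e j)), (\<lambda>j\<in>{1..l}. nat (- e j))) \<in> Q_index l"
        by (auto simp: Q_index_def)
    qed
  qed
  have Q_term: "f (\<phi> x) = Q_term p l A B \<alpha> \<beta> x" if x: "x \<in> Q_index l" for x
  proof -
    obtain M N where MN: "x = (M, N)" by (cases x)
    define T where "T j = Sigma_series p (A j) (B j) (\<alpha> j) (\<beta> j) (M j) (N j)
        * Xpow p (of_nat (M j) * (1 - \<beta> j) - of_nat (N j) * \<alpha> j)" for j
    \<comment> \<open>The weight in \<open>Q_term\<close> differs from that of the local coefficient
      by \<open>s\<close> to the power \<open>M j - N j\<close>; multiplying both sides by powers of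
      \<open>s\<close> avoids a negative exponent.\<close>
    have eq: "S j (\<phi> x j) * s ^ M j = T j * s ^ N j" if j: "j \<in> {1..l}" for j
    proof -
      have "Xpow p (1/2 - \<beta> j) ^ M j * Xpow p (1/2 - \<alpha> j) ^ N j * s ^ M j =
          Xpow p (of_nat (M j) * (1 - \<beta> j) - of_nat (N j) * \<alpha> j) * s ^ N j"
        using p by (simp add: s_def algebra_simps flip: Xpow_of_nat_mult Xpow_add)
      moreover have "S j (\<phi> x j) = Sigma_series p (A j) (B j) (\<alpha> j) (\<beta> j) (M j) (N j)
          * Xpow p (1/2 - \<beta> j) ^ M j * Xpow p (1/2 - \<alpha> j) ^ N j"
        using Sigma_series_local_coeff(2)[OF p, of "A j" "B j" "\<alpha> j" "\<beta> j" "M j" "N j"] bounds j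
        by (auto simp: S_def \<phi>_def MN)
      ultimately show ?thesis by (simp add: T_def mult.assoc)
    qed
    have "f (\<phi> x) * s ^ (\<Sum>j=1..l. M j) = (\<Prod>j=1..l. S j (\<phi> x j) * s ^ M j)"
      by (simp add: f_def prod.distrib power_sum)
    also have "\<dots> = (\<Prod>j=1..l. T j * s ^ N j)"
      by (rule prod.cong) (use eq in auto)
    also have "\<dots> = Q_term p l A B \<alpha> \<beta> x * s ^ (\<Sum>j=1..l. N j)"
      by (simp add: Q_term_def MN T_def prod.distrib power_sum)
    \<comment> \<open>Here the constraint in \<open>Q_index\<close> makes the leftover powers of
      \<open>s\<close> equal, so they cancel in the product although not in the single
      factors.\<close>
    also have "(\<Sum>j=1..l. N j) = (\<Sum>j=1..l. M j)"
      using x by (simp add: MN Q_index_def)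
    finally show ?thesis using s0 by simp
  qed
  have "(\<lambda>x. norm (f (\<phi> x))) summable_on Q_index l"
    using summable_on_subset_banach[OF f_abs]
    by (subst summable_on_reindex_bij_betw[OF bij, of "\<lambda>e. norm (f e)"]) auto
  hence "Q_term p l A B \<alpha> \<beta> abs_summable_on Q_index l"
    by (rule summable_on_cong[THEN iffD1, rotated]) (simp add: Q_term)
  moreover have "Q_series p l A B \<alpha> \<beta> = c * C_series p A' B'"
    unfolding Q_series_def const[symmetric] infsum_reindex_bij_betw[OF bij, symmetric]
    by (rule infsum_cong) (simp add: Q_term)
  moreover have "\<forall>j\<in>{1..l}. \<forall>M N. Sigma_term p (A j) (B j) (\<alpha> j) (\<beta> j) M N abs_summable_on Sigma_index"
    by (intro ballI allI Sigma_series_local_coeff(1); use p bounds in blast)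
  ultimately show ?thesis
    using C_abs unfolding Let_def A'_def[symmetric] B'_def[symmetric] c_def by blast
qed

end
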